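(* Let $\rho = 2+\sqrt{3}$. For every finite set $S$ of points in the Euclidean plane and every admissible ordering $\prec$ of the pairs of points of $S$, the Yao graph $Y_5$ on $S$ is a $\rho$-spanner; that is, for every two points $u,v\in S$ the shortest-path distance in $Y_5$ satisfies $d_{Y_5}(u,v)\le (2+\sqrt{3})\,\|uv\|$.
   Context: $\|ab\|$ denotes Euclidean distance. Let $S$ be a finite set of points in the plane. An admissible ordering $\prec$ is a strict total order on the unordered pairs $\{a,b\}$ of distinct points of $S$ such that $\|ab\|<\|cd\|$ implies $\{a,b\}\prec\{c,d\}$ (ties in distance are broken arbitrarily). Cones: for each point $p$, the plane around $p$ is partitioned into five cones $C_1^p,\dots,C_5^p$ with apex $p$, each of angle $2\pi/5$, labelled counterclockwise, where $C_i^p$ consists of the points $q\neq p$ such that the direction of $\overrightarrow{pq}$, measured counterclockwise from the positive $x$-axis, lies in $[2\pi(i-1)/5,\,2\pi i/5)$. The orientation is the same for all points. Directed Yao graph $\overrightarrow{Y_5}$: for each $p\in S$ and each $i$ such that $C_i^p$ contains a point of $S$, let $q\in S\cap C_i^p$ be the point for which $\{p,q\}$ is minimal with respect to $\prec$; then the directed edge $(p,q)$ is in $\overrightarrow{Y_5}$. The Yao graph $Y_5$ is the underlying undirected graph of $\overrightarrow{Y_5}$. For a graph $G$ on $S$ whose edges $ab$ have length $\|ab\|$, $d_G(a,b)$ is the minimum total length of a path in $G$ from $a$ to $b$ ($+\infty$ if none exists). $G$ is a $\rho$-spanner if $d_G(a,b)\le\rho\|ab\|$ for all $a,b\in S$.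 *)

theory Defs
  imports
    "Graph_Theory.Digraph_Component"
    "Graph_Theory.Shortest_Path"
    "HOL-Analysis.Analysis"
begin

text \<open>The Euclidean plane is \<^typ>\<open>complex\<close>, where \<^term>\<open>dist\<close> is the Euclidean distance and
  \<^term>\<open>Arg2pi\<close> is the counterclockwise angle from the positive real axis, with values in
  the half-open interval from \<open>0\<close> to \<open>2 * pi\<close>.\<close>

definition point_pairs :: "complex set \<Rightarrow> complex set set" where
  "point_pairs S = {{a, b} | a b. a \<in> S \<and> b \<in> S \<and> a \<noteq> b}"

text \<open>The order is a predicate on all sets of points, but it is constrained (and used below)
  only on \<^term>\<open>point_pairs S\<close>.\<close>

definition admissible_ordering ::
    "complex set \<Rightarrow> (complex set \<Rightarrow> complex set \<Rightarrow> bool) \<Rightarrow> bool" where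
  "admissible_ordering S prec \<longleftrightarrow>
     irreflp_on (point_pairs S) prec \<and>
     transp_on (point_pairs S) prec \<and>
     totalp_on (point_pairs S) prec \<and>
     (\<forall>a\<in>S. \<forall>b\<in>S. \<forall>c\<in>S. \<forall>d\<in>S.
        a \<noteq> b \<longrightarrow> c \<noteq> d \<longrightarrow> dist a b < dist c d \<longrightarrow> prec {a, b} {c, d})"

definition cone5 :: "nat \<Rightarrow> complex \<Rightarrow> complex set" where
  "cone5 i p = {q. q \<noteq> p \<and>
     2 * pi * (real i - 1) / 5 \<le> Arg2pi (q - p) \<and> Arg2pi (q - p) < 2 * pi * real i / 5}"

definition directed_yao5 ::
    "complex set \<Rightarrow> (complex set \<Rightarrow> complex set \<Rightarrow> bool) \<Rightarrow> complex pair_pre_digraph" where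
  "directed_yao5 S prec =
     \<lparr> pverts = S,
       parcs = {(p, q) | p q. p \<in> S \<and> (\<exists>i\<in>{1..5}. q \<in> S \<inter> cone5 i p \<and>
                  (\<forall>r \<in> S \<inter> cone5 i p. r \<noteq> q \<longrightarrow> prec {p, q} {p, r}))} \<rparr>"

text \<open>Undirected graphs are represented by symmetric digraphs.\<close>

definition yao5 ::
    "complex set \<Rightarrow> (complex set \<Rightarrow> complex set \<Rightarrow> bool) \<Rightarrow> complex pair_pre_digraph" where
  "yao5 S prec = mk_symmetric (with_proj (directed_yao5 S prec))"

text \<open>\<^const>\<open>wf_digraph.\<mu>\<close> is the infimum of the costs of the walks between two vertices, which is
  \<open>\<infinity>\<close> if there are none. In a finite graph with nonnegative arc costs
  it is the minimum cost of a path whenever there is one.\<close>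

definition graph_dist :: "complex pair_pre_digraph \<Rightarrow> complex \<Rightarrow> complex \<Rightarrow> ereal" where
  "graph_dist G a b = wf_digraph.\<mu> (with_proj G) (\<lambda>(x, y). dist x y) a b"

definition spanner :: "real \<Rightarrow> complex pair_pre_digraph \<Rightarrow> bool" where
  "spanner \<rho> G \<longleftrightarrow>
     (\<forall>a\<in>pverts G. \<forall>b\<in>pverts G. graph_dist G a b \<le> ereal (\<rho> * dist a b))"

text \<open>The defining equation of \<^const>\<open>wf_digraph.\<mu>\<close> is conditional on the locale predicate, which
  holds here.\<close>

lemma wf_digraph_yao5: "wf_digraph (with_proj (yao5 S prec))"
  by unfold_locales (auto simp: yao5_def parcs_mk_symmetric directed_yao5_def)

lemma graph_dist_yao5:
  "graph_dist (yao5 S prec) a b =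
     (INF p \<in> {p. pre_digraph.awalk (with_proj (yao5 S prec)) a p b}.
        ereal (\<Sum>(x, y)\<leftarrow>p. dist x y))"
  unfolding graph_dist_def wf_digraph.\<mu>_def[OF wf_digraph_yao5]
    wf_digraph.awalk_cost_def[OF wf_digraph_yao5] ..

end

theory Submission
  imports Defs
begin

text \<open>
  Induction on the distance of \<open>a\<close> and \<open>b\<close>. Let \<open>c\<close> be the Yao neighbour of \<open>a\<close> in the cone
  containing \<open>b\<close>, and \<open>d\<close> the Yao neighbour of \<open>b\<close> in the cone containing \<open>a\<close>. It suffices that one
  of the routes \<open>a c \<leadsto> b\<close>, \<open>a \<leadsto> d b\<close> and \<open>a c \<leadsto> d b\<close> is short enough, where the induction
  hypothesis bounds the part \<open>\<leadsto>\<close>. If the first two are not, both angles \<open>\<beta> = bac\<close> and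
  \<open>\<gamma> = abd\<close> have cosine less than \<open>sqrt 3 - 1\<close>, so they exceed 36 degrees. Since the number of
  cones is odd, the cones of \<open>a\<close> and \<open>b\<close> are offset by 36 degrees, which forces \<open>c\<close> and \<open>d\<close> to
  lie on the same side of \<open>ab\<close> with \<open>\<beta> + \<gamma>\<close> at most 108 degrees; then \<open>c\<close> and \<open>d\<close> are close
  enough for the third route. The ratio is attained by this argument when
  \<open>ac = bd = ab\<close> and \<open>cos \<beta> = cos \<gamma> = sqrt 3 - 1\<close>.
\<close>

section \<open>Cosine estimates near multiples of 36 degrees\<close>

text \<open>Since 3 pi/5 and 2 pi/5 add up to pi, the triple and double angle formulas give a cubic
  for \<open>cos (pi/5)\<close>; splitting off the root -1 leaves a quadratic.\<close>

lemma cos_pi_fifth_bounds: "4/5 < cos (pi/5)" "cos (pi/5) < 81/100"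
proof -
  define c where "c = cos (pi/5)"
  have c0: "c > 0" unfolding c_def by (rule cos_gt_zero_pi) (use pi_gt_zero in linarith)+
  have "cos (3 * (pi/5)) = - cos (2 * (pi/5))"
    using cos_pi_minus[of "2 * (pi/5)"] by (simp add: field_simps)
  then have "4 * c^3 - 3 * c = - (2 * c\<^sup>2 - 1)"
    unfolding cos_treble_cos cos_double_cos c_def by simp
  then have "(c + 1) * (4 * c\<^sup>2 - 2 * c - 1) = 0"
    by (simp add: power2_eq_square power3_eq_cube algebra_simps)
  moreover have "c + 1 \<noteq> 0" using c0 by simp
  ultimately have "4 * c\<^sup>2 - 2 * c - 1 = 0" by simp
  \<comment> \<open>As a product of increasing factors, the equation can be compared directly with
    its value at a rational point.\<close>
  then have e: "c * (4 * c - 2) = 1"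
    by (simp add: power2_eq_square algebra_simps)
  show "4/5 < cos (pi/5)"
  proof (rule ccontr)
    assume "\<not> ?thesis"
    then have "c \<le> 4/5" by (simp add: c_def)
    then have "c * (4 * c - 2) \<le> c * (6/5)"
      using c0 by (intro mult_left_mono) auto
    then show False using e \<open>c \<le> 4/5\<close> by simp
  qed
  show "cos (pi/5) < 81/100"
  proof (rule ccontr)
    assume "\<not> ?thesis"
    then have "81/100 \<le> c" by (simp add: c_def)
    then have "81/100 * (4 * (81/100) - 2) \<le> c * (4 * c - 2)"
      by (intro mult_mono) auto
    then show False using e by simp
  qed
qed

text \<open>By the sum-to-product formula: the half sum is at most 3 pi/10, and the half difference
  is at most pi/10 in absolute value.\<close>

lemma cos_add_cos_ge:
  assumes "pi/5 \<le> \<beta>" "pi/5 \<le> \<gamma>" "\<beta> + \<gamma> \<le> 3*pi/5"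
  shows "111/100 \<le> cos \<beta> + cos \<gamma>"
proof -
  have "sin (pi/5) = cos (3*pi/10)"
    by (simp add: sin_cos_eq field_simps)
  also have "\<dots> \<le> cos ((\<beta> + \<gamma>)/2)"
    using assms by (intro cos_monotone_0_pi_le) auto
  finally have 1: "sin (pi/5) \<le> cos ((\<beta> + \<gamma>)/2)" .
  have "\<bar>(\<beta> - \<gamma>)/2\<bar> \<le> pi/10"
    unfolding abs_le_iff using assms by argo
  then have "cos (pi/10) \<le> cos (\<bar>(\<beta> - \<gamma>)/2\<bar>)"
    using pi_gt_zero by (intro cos_monotone_0_pi_le) linarith+
  then have 2: "cos (pi/10) \<le> cos ((\<beta> - \<gamma>)/2)" by (simp only: cos_abs_real)
  have "(cos (pi/5))\<^sup>2 \<le> (81/100)\<^sup>2"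
    using cos_pi_fifth_bounds by (intro power_mono) auto
  then have "(586/1000)\<^sup>2 \<le> (sin (pi/5))\<^sup>2"
    unfolding sin_squared_eq by (simp add: power2_eq_square)
  then have 3: "586/1000 \<le> sin (pi/5)"
    by (rule power2_le_imp_le) (simp add: sin_ge_zero)
  have "cos (pi/5) = 2 * (cos (pi/10))\<^sup>2 - 1"
    using cos_double_cos[of "pi/10"] by simp
  then have "(948/1000)\<^sup>2 \<le> (cos (pi/10))\<^sup>2"
    using cos_pi_fifth_bounds(1) by (simp add: power2_eq_square)
  then have 4: "948/1000 \<le> cos (pi/10)"
    by (rule power2_le_imp_le) (rule cos_ge_zero; use pi_gt_zero in linarith)
  have "586/1000 * (948/1000) \<le> cos ((\<beta> + \<gamma>)/2) * cos ((\<beta> - \<gamma>)/2)"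
    using 1 2 3 4 by (intro mult_mono) auto
  then show ?thesis by (simp add: cos_plus_cos)
qed

subsection \<open>Two Yao edges towards each other\<close>

lemma convex_quadratic_nonpos:
  fixes A B C s t x :: real
  assumes "0 \<le> A" "A * s\<^sup>2 + B * s + C \<le> 0" "A * t\<^sup>2 + B * t + C \<le> 0" "s \<le> x" "x \<le> t"
  shows "A * x\<^sup>2 + B * x + C \<le> 0"
proof (cases "s = t")
  case True
  then show ?thesis using assms by auto
next
  case False
  \<comment> \<open>The value at \<open>x\<close> is the chord value minus a nonnegative multiple of
    \<open>A\<close>.\<close>
  have "(t - s) * (A * x\<^sup>2 + B * x + C) =
      (t - x) * (A * s\<^sup>2 + B * s + C) + (x - s) * (A * t\<^sup>2 + B * t + C) - A * ((t - s) * ((t - x) * (x - s)))"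
    by (simp add: algebra_simps power2_eq_square)
  also have "\<dots> \<le> 0"
    using assms
    by (smt (verit) mult_nonneg_nonneg mult_nonneg_nonpos)
  finally show ?thesis using False assms by (smt (verit) mult_le_0_iff)
qed

text \<open>This is the inequality of \<open>quadratic_form_bound\<close> at the corner
  \<open>x = 1 - u/m\<close>, \<open>y = 1\<close>, where the first summand on the left vanishes.
  Exchanging \<open>u\<close> and \<open>v\<close> gives the opposite corner.\<close>

lemma corner_bound:
  fixes m u v W :: real
  assumes m: "464/1000 \<le> m" and uv: "0 \<le> u" "0 \<le> v" "u + v \<le> 355/1000"
    and W: "1185/1000 * (u + v) - 5/9 * (u * v) \<le> W"
  shows "v \<le> (1 - u/m) * W"
proof -
  \<comment> \<open>The constant 2.156 is just above 1/0.464, hence at least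
    \<open>1/m\<close>.\<close>
  have z: "1 - 2156/1000 * u \<le> 1 - u/m"
  proof -
    have "u * 1 \<le> u * (2156/1000 * m)" using m uv by (intro mult_left_mono) auto
    then show ?thesis using m by (simp add: field_simps)
  qed
  have u: "u * (u + v) \<le> u * (355/1000)" "u * v \<le> u * (355/1000)"
    using uv by (intro mult_left_mono; simp)+
  have p: "0 \<le> u * (u * v)" "0 \<le> u * v" using uv by auto
  have W0: "0 \<le> W" using W u(2) uv by (simp add: algebra_simps)
  have "v \<le> (1 - 2156/1000 * u) * (1185/1000 * (u + v) - 5/9 * (u * v))"
  proof -
    have "(1 - 2156/1000 * u) * (1185/1000 * (u + v) - 5/9 * (u * v)) =
        1185/1000 * (u + v) - 5/9 * (u * v) - 2156/1000 * (1185/1000) * (u * (u + v))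
        + 2156/1000 * (5/9) * (u * (u * v))"
      by (simp add: field_simps)
    then show ?thesis using u p uv by argo
  qed
  also have "\<dots> \<le> (1 - 2156/1000 * u) * W"
    using W uv by (intro mult_left_mono) auto
  also have "\<dots> \<le> (1 - u/m) * W"
    using z W0 by (intro mult_right_mono) auto
  finally show ?thesis .
qed

text \<open>The left side minus the right side is convex in \<open>x\<close> and in \<open>y\<close>, so only the four corners of
  the rectangle matter.\<close>

lemma quadratic_form_bound:
  fixes m u v W x y :: real
  assumes m: "464/1000 \<le> m" and uv: "0 \<le> u" "0 \<le> v" "u + v \<le> 355/1000"
    and W: "1185/1000 * (u + v) - 5/9 * (u * v) \<le> W"
    and x: "1 - u/m \<le> x" "x \<le> 1" and y: "1 - v/m \<le> y" "y \<le> 1"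
  shows "x * (m * x - m + u) + y * (m * y - m + v) \<le> x * y * W"
proof -
  have m0: "m > 0" using m by simp
  have "u * v \<le> u * (355/1000)" "v * u \<le> v * (355/1000)"
    using uv by (intro mult_left_mono; simp)+
  then have W1: "u + v \<le> W" using uv W unfolding mult.commute[of v u] by argo
  have cu: "v \<le> (1 - u/m) * W" using corner_bound[OF m uv W] .
  have cv: "u \<le> (1 - v/m) * W"
    by (rule corner_bound[OF m]) (use uv W in \<open>simp_all add: algebra_simps\<close>)
  define p where "p = 1 - u/m"
  define q where "q = 1 - v/m"
  have um: "u = m * (1 - p)" "v = m * (1 - q)" using m0 by (simp_all add: p_def q_def)
  have pq: "0 \<le> p" "0 \<le> q" using m uv by (simp_all add: p_def q_def field_simps)
  define H where "H = (\<lambda>x y. m * x\<^sup>2 + (u - m - y * W) * x + y * (m * y - m + v))"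
  have Hsym: "H x y = m * y\<^sup>2 + (v - m - x * W) * y + x * (m * x - m + u)" for x y
    by (simp add: H_def algebra_simps power2_eq_square)
  have W0: "0 \<le> W" using W1 uv by simp
  have pp: "0 \<le> p * (q * W)" using pq W0 by simp
  \<comment> \<open>With \<open>u\<close> and \<open>v\<close> expressed by \<open>p\<close> and
    \<open>q\<close>, the corner values are \<open>- p * q * W\<close>, \<open>u - q * W\<close>,
    \<open>v - p * W\<close> and \<open>u + v - W\<close>.\<close>
  have H1: "H p q \<le> 0" "H 1 q \<le> 0" "H p 1 \<le> 0" "H 1 1 \<le> 0"
    using cu cv W1 pp unfolding p_def[symmetric] q_def[symmetric]
    unfolding H_def um by (simp_all add: algebra_simps power2_eq_square)
  have Hy: "H p y \<le> 0" "H 1 y \<le> 0"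
    unfolding Hsym by (rule convex_quadratic_nonpos[OF _ _ _ y[folded q_def]]; use H1 m0 Hsym in simp)+
  have "H x y \<le> 0"
    unfolding H_def
    by (rule convex_quadratic_nonpos[OF _ Hy[unfolded H_def] x[folded p_def]]) (use m0 in simp)
  then show ?thesis by (simp add: H_def algebra_simps power2_eq_square)
qed

lemma sqrt3_bounds: "1732/1000 \<le> sqrt 3" "sqrt 3 \<le> 173206/100000"
  by (rule real_le_rsqrt real_le_lsqrt; simp add: power2_eq_square)+

text \<open>A chord bound for the concave function \<open>sqrt (1 - t\<^sup>2)\<close>, exact at \<open>t = sqrt 3 - 1\<close>, which is
  the tight case of the theorem.\<close>

lemma sin_chord:
  assumes s0: "0 \<le> s0" "s0\<^sup>2 = 2 * sqrt 3 - 3" and u: "0 \<le> u" "u \<le> 355/1000"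
    and c: "cos \<beta> = sqrt 3 - 1 - u" and s: "0 \<le> sin \<beta>"
  shows "s0 + 2/3 * u \<le> sin \<beta>"
proof (rule power2_le_imp_le[OF _ s])
  have s0': "s0 \<le> 682/1000"
    by (rule power2_le_imp_le) (use s0(2) sqrt3_bounds in \<open>simp_all add: power2_eq_square\<close>)
  \<comment> \<open>The constant term cancels by the choice of \<open>s0\<close>, which leaves the
    factor \<open>u\<close>.\<close>
  have "(sin \<beta>)\<^sup>2 - (s0 + 2/3 * u)\<^sup>2 = u * (2 * (sqrt 3 - 1) - 4/3 * s0 - 13/9 * u)"
    using s0(2) unfolding sin_squared_eq c by (simp add: power2_eq_square algebra_simps)
  also have "\<dots> \<ge> 0"
    using u s0' sqrt3_bounds by (intro mult_nonneg_nonneg) auto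
  finally show "(s0 + 2/3 * u)\<^sup>2 \<le> (sin \<beta>)\<^sup>2" by simp
qed

text \<open>Expand the cosine of the sum and bound the product of sines by two chords. The constant
  terms cancel, so the bound vanishes in the tight case \<open>u = v = 0\<close>; the coefficient of
  \<open>u * v\<close> is 4/9 - 1.\<close>

lemma cos_add_le:
  assumes u: "0 \<le> u" "cos \<beta> = sqrt 3 - 1 - u" "0 \<le> sin \<beta>"
    and v: "0 \<le> v" "cos \<gamma> = sqrt 3 - 1 - v" "0 \<le> sin \<gamma>"
    and uv: "u + v \<le> 355/1000"
  shows "1185/1000 * (u + v) - 5/9 * (u * v) \<le> (2 - sqrt 3)\<^sup>2 - cos (\<beta> + \<gamma>)"
proof -
  define s0 where "s0 = sqrt (2 * sqrt 3 - 3)"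
  have s0: "0 \<le> s0" "s0\<^sup>2 = 2 * sqrt 3 - 3" using sqrt3_bounds by (auto simp: s0_def)
  have s0': "68/100 \<le> s0"
    by (rule power2_le_imp_le) (use s0 sqrt3_bounds in \<open>simp_all add: power2_eq_square\<close>)
  have "(s0 + 2/3 * u) * (s0 + 2/3 * v) \<le> sin \<beta> * sin \<gamma>"
    using u v uv s0 by (intro mult_mono sin_chord) auto
  moreover have "(s0 + 2/3 * u) * (s0 + 2/3 * v) = s0\<^sup>2 + 2/3 * s0 * (u + v) + 4/9 * (u * v)"
    by (simp add: power2_eq_square algebra_simps)
  moreover have "cos (\<beta> + \<gamma>) =
      (sqrt 3 - 1)\<^sup>2 - (sqrt 3 - 1) * (u + v) + u * v - sin \<beta> * sin \<gamma>"
    unfolding cos_add u(2) v(2) by (simp add: power2_eq_square algebra_simps)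
  moreover have "1185/1000 * (u + v) \<le> (sqrt 3 - 1 + 2/3 * s0) * (u + v)"
    using s0' sqrt3_bounds u v by (intro mult_right_mono) auto
  moreover have "(sqrt 3 - 1 + 2/3 * s0) * (u + v) = (sqrt 3 - 1) * (u + v) + 2/3 * s0 * (u + v)"
    by (simp only: distrib_right)
  moreover have "(sqrt 3 - 1)\<^sup>2 = 4 - 2 * sqrt 3" "(2 - sqrt 3)\<^sup>2 = 7 - 4 * sqrt 3"
    by (simp_all add: power2_eq_square algebra_simps)
  ultimately show ?thesis
    using s0(2) by argo
qed

text \<open>With \<open>ab\<close> scaled to 1 and \<open>x\<close> the length of the Yao edge,
  \<open>f\<close> says that the route over this edge alone is too long. Divide by
  \<open>2 + sqrt 3\<close>, isolate the root, square, and cancel \<open>x\<close>.\<close>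

lemma one_edge_fails:
  assumes x: "0 < x" "x \<le> 1"
    and f: "2 + sqrt 3 < x + (2 + sqrt 3) * sqrt (1 + x\<^sup>2 - 2 * x * cos \<beta>)"
  shows "cos \<beta> < 2 - sqrt 3 + (2 * sqrt 3 - 3) * x"
proof -
  define k where "k = 2 - sqrt 3"
  define Q where "Q = 1 + x\<^sup>2 - 2 * x * cos \<beta>"
  have k: "k * (2 + sqrt 3) = 1" "0 < k" "k < 1" "k\<^sup>2 = 7 - 4 * sqrt 3"
    using sqrt3_bounds by (auto simp: k_def algebra_simps power2_eq_square)
  have "k * (2 + sqrt 3) < k * (x + (2 + sqrt 3) * sqrt Q)"
    using f k(2) unfolding Q_def by (intro mult_strict_left_mono) auto
  also have "\<dots> = k * x + (k * (2 + sqrt 3)) * sqrt Q" by (simp add: algebra_simps)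
  finally have g: "1 - k * x < sqrt Q" using k(1) by simp
  have "k * x \<le> 1 * 1" using k x by (intro mult_mono) auto
  then have n: "0 \<le> 1 - k * x" by simp
  have "(1 - k * x)\<^sup>2 < Q"
    using g n by (meson real_le_lsqrt not_le)
  then have "x * (2 * cos \<beta>) < x * (2 * k + (1 - k\<^sup>2) * x)"
    by (simp add: Q_def power2_eq_square algebra_simps)
  then have "2 * cos \<beta> < 2 * k + (1 - (7 - 4 * sqrt 3)) * x" using x by (simp add: k(4))
  then show ?thesis by (simp add: k_def algebra_simps)
qed

text \<open>With \<open>k = 1 / (2 + sqrt 3)\<close>, the claim is equivalent to
  \<open>x (m x - m + u) + y (m y - m + v) \<le> x y (k\<^sup>2 - cos (\<beta> + \<gamma>))\<close>, where
  \<open>m = (1 - k\<^sup>2) / 2\<close>, and \<open>u\<close> and \<open>v\<close> measure how far the cosines are below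
  \<open>k + m = sqrt 3 - 1\<close>.\<close>

lemma two_edges:
  assumes x: "0 < x" "x \<le> 1" and y: "0 < y" "y \<le> 1"
    and fx: "cos \<beta> < 2 - sqrt 3 + (2 * sqrt 3 - 3) * x"
    and fy: "cos \<gamma> < 2 - sqrt 3 + (2 * sqrt 3 - 3) * y"
    and ang: "pi/5 \<le> \<beta>" "pi/5 \<le> \<gamma>" "\<beta> + \<gamma> \<le> 3*pi/5"
  shows "x + y + (2 + sqrt 3) *
      sqrt (1 + x\<^sup>2 + y\<^sup>2 - 2 * x * cos \<beta> - 2 * y * cos \<gamma> + 2 * x * y * cos (\<beta> + \<gamma>)) \<le> 2 + sqrt 3"
proof -
  define k where "k = 2 - sqrt 3"
  define m where "m = 2 * sqrt 3 - 3"
  define u where "u = sqrt 3 - 1 - cos \<beta>"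
  define v where "v = sqrt 3 - 1 - cos \<gamma>"
  define W where "W = k\<^sup>2 - cos (\<beta> + \<gamma>)"
  have m: "464/1000 \<le> m" using sqrt3_bounds by (simp add: m_def)
  have k: "(2 + sqrt 3) * k = 1" "0 < k" "2 * k < 1" "1 - k\<^sup>2 = 2 * m" "k + m = sqrt 3 - 1"
    using sqrt3_bounds by (auto simp: k_def m_def algebra_simps power2_eq_square)
  have mx: "m * x \<le> m" "m * y \<le> m" using x y m by auto
  have u0: "0 \<le> u" using fx mx k unfolding u_def k_def[symmetric] m_def[symmetric] by linarith
  have v0: "0 \<le> v" using fy mx k unfolding v_def k_def[symmetric] m_def[symmetric] by linarith
  \<comment> \<open>The constant is \<open>2 * (sqrt 3 - 1) - 111/100\<close>, rounded up.\<close>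
  have uv: "u + v \<le> 355/1000"
    using cos_add_cos_ge[OF ang] sqrt3_bounds by (simp add: u_def v_def)
  have Wb: "1185/1000 * (u + v) - 5/9 * (u * v) \<le> W"
    unfolding W_def k_def by (rule cos_add_le)
      (use u0 v0 uv ang pi_gt_zero in \<open>auto simp: u_def v_def intro!: sin_ge_zero\<close>)
  \<comment> \<open>Rewritten in \<open>u\<close> and \<open>v\<close>, the failure of the one-edge
    routes gives the lower sides of the rectangle.\<close>
  have x0: "1 - u/m \<le> x" "1 - v/m \<le> y"
    using fx fy k m unfolding u_def v_def k_def[symmetric] m_def[symmetric]
    by (simp_all add: field_simps)
  have H: "x * (m * x - m + u) + y * (m * y - m + v) \<le> x * y * W"
    by (rule quadratic_form_bound[OF m u0 v0 uv Wb x0(1) x(2) x0(2) y(2)])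
  define G where "G = 1 + x\<^sup>2 + y\<^sup>2 - 2 * x * cos \<beta> - 2 * y * cos \<gamma> + 2 * x * y * cos (\<beta> + \<gamma>)"
  have c: "cos \<beta> = k + m - u" "cos \<gamma> = k + m - v" "cos (\<beta> + \<gamma>) = k\<^sup>2 - W"
    using k by (simp_all add: u_def v_def W_def)
  have "G - (1 - k * (x + y))\<^sup>2 =
      (1 - k\<^sup>2) * (x\<^sup>2 + y\<^sup>2) - 2 * x * (m - u) - 2 * y * (m - v) - 2 * x * y * W"
    unfolding G_def c by (simp add: power2_eq_square algebra_simps)
  also have "\<dots> = 2 * (x * (m * x - m + u) + y * (m * y - m + v) - x * y * W)"
    unfolding k(4) by (simp add: power2_eq_square algebra_simps)
  also have "\<dots> \<le> 0" using H by simp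
  finally have G: "G \<le> (1 - k * (x + y))\<^sup>2" by simp
  have "k * (x + y) \<le> k * 2" using x y k by (intro mult_left_mono) auto
  then have "0 \<le> 1 - k * (x + y)" using k(3) by linarith
  then have "sqrt G \<le> 1 - k * (x + y)" using G by (simp add: real_le_lsqrt)
  then have "(2 + sqrt 3) * sqrt G \<le> (2 + sqrt 3) * (1 - k * (x + y))"
    by (intro mult_left_mono) auto
  also have "\<dots> = 2 + sqrt 3 - ((2 + sqrt 3) * k) * (x + y)" by (simp only: algebra_simps)
  finally show ?thesis unfolding k(1) G_def by simp
qed

subsection \<open>Opposite cones\<close>

text \<open>The value 4/5 separates \<open>sqrt 3 - 1\<close> from
  \<open>cos (pi/5)\<close>.\<close>

lemma cos_less_imp_abs_gt:
  assumes "cos \<beta> < 4/5" "\<bar>\<beta>\<bar> \<le> pi"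
  shows "pi/5 < \<bar>\<beta>\<bar>"
proof (rule ccontr)
  assume "\<not> ?thesis"
  then have "cos (pi/5) \<le> cos \<bar>\<beta>\<bar>"
    by (intro cos_monotone_0_pi_le) auto
  then show False using assms cos_pi_fifth_bounds by (simp add: cos_abs_real)
qed

text \<open>Angles are measured in units of pi/5 from the first ray of each cone. Cone boundaries
  are even multiples of this unit and pi is an odd one, so the positions of the two opposite
  directions differ by exactly one unit.\<close>

lemma cone_angles:
  fixes i j :: nat
  assumes \<phi>: "2*pi*(real i - 1)/5 \<le> \<phi>" "\<phi> < 2*pi*real i/5"
    and \<alpha>: "2*pi*(real i - 1)/5 \<le> \<alpha>" "\<alpha> < 2*pi*real i/5"
    and \<psi>: "2*pi*(real j - 1)/5 \<le> \<psi>" "\<psi> < 2*pi*real j/5"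
    and \<delta>: "2*pi*(real j - 1)/5 \<le> \<delta>" "\<delta> < 2*pi*real j/5"
    and opp: "\<psi> = \<phi> + pi \<or> \<psi> = \<phi> - pi"
    and big: "pi/5 < \<bar>\<alpha> - \<phi>\<bar>" "pi/5 < \<bar>\<psi> - \<delta>\<bar>"
  shows "(pi/5 \<le> \<alpha> - \<phi> \<and> pi/5 \<le> \<psi> - \<delta> \<and> (\<alpha> - \<phi>) + (\<psi> - \<delta>) \<le> 3*pi/5) \<or>
         (pi/5 \<le> \<phi> - \<alpha> \<and> pi/5 \<le> \<delta> - \<psi> \<and> (\<phi> - \<alpha>) + (\<delta> - \<psi>) \<le> 3*pi/5)"
proof -
  define t where "t = pi/5"
  define f where "f = \<phi> - 2 * (real i - 1) * t"
  define a where "a = \<alpha> - 2 * (real i - 1) * t"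
  define g where "g = \<psi> - 2 * (real j - 1) * t"
  define d where "d = \<delta> - 2 * (real j - 1) * t"
  have t: "0 < t" "pi = 5 * t" by (simp_all add: t_def)
  have b: "0 \<le> f" "f < 2*t" "0 \<le> a" "a < 2*t" "0 \<le> g" "g < 2*t" "0 \<le> d" "d < 2*t"
    using \<phi> \<alpha> \<psi> \<delta> by (simp_all add: f_def a_def g_def d_def t(2) algebra_simps)
  have e: "\<alpha> - \<phi> = a - f" "\<psi> - \<delta> = g - d" "\<phi> - \<alpha> = f - a" "\<delta> - \<psi> = d - g"
    by (simp_all add: f_def a_def g_def d_def)
  \<comment> \<open>\<open>g - f\<close> is an odd multiple of \<open>t\<close> in absolute value below \<open>2 * t\<close>.\<close>
  have gf: "g - f = t \<or> g - f = - t"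
  proof -
    obtain n :: int where n: "g - f = (2 * of_int n + 1) * t"
    proof (cases "\<psi> = \<phi> + pi")
      case True
      then show ?thesis
        by (intro that[of "2 + int i - int j"]) (simp add: g_def f_def t(2) algebra_simps)
    next
      case False
      then show ?thesis using opp
        by (intro that[of "int i - int j - 3"]) (simp add: g_def f_def t(2) algebra_simps)
    qed
    have "(2 * of_int n + 1) * t < 2 * t" "(-2) * t < (2 * of_int n + 1) * t"
      using b n by linarith+
    then have "2 * real_of_int n + 1 < 2" "-2 < 2 * real_of_int n + 1"
      using t(1) by (simp_all only: mult_less_cancel_right_pos)
    then have "n = 0 \<or> n = -1" by linarith
    then show ?thesis using n by auto
  qed
  \<comment> \<open>If \<open>g - f = t\<close>, then \<open>f < t \<le> g\<close>, so the large
    deviations must be \<open>a > f + t\<close> and \<open>d < g - t\<close>; their sum is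
    \<open>a - d + t < 3 * t\<close>. The other case is its mirror image.\<close>
  then show ?thesis
    using b big t(1) unfolding e t(2) by (auto simp: abs_if split: if_splits)
qed

section \<open>Squared distances in polar form, and the three detours\<close>

lemma cmod_diff_cis_squared:
  "(cmod (complex_of_real s * cis \<alpha> - complex_of_real r * cis \<phi>))\<^sup>2 =
     r\<^sup>2 + s\<^sup>2 - 2 * r * s * cos (\<alpha> - \<phi>)"
  using sin_cos_squared_add[of \<alpha>] sin_cos_squared_add[of \<phi>]
  unfolding cmod_power2 cos_diff minus_complex.sel times_complex.sel cis.sel
    Re_complex_of_real Im_complex_of_real
  by algebra

lemma cmod_diff_diff_cis_squared:
  "(cmod (complex_of_real s * cis \<alpha> - complex_of_real r * cis \<phi> - complex_of_real t * cis \<delta>))\<^sup>2 =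
     r\<^sup>2 + s\<^sup>2 + t\<^sup>2 - 2 * r * s * cos (\<alpha> - \<phi>) + 2 * r * t * cos (\<phi> - \<delta>)
     - 2 * s * t * cos (\<alpha> - \<delta>)"
  using sin_cos_squared_add[of \<alpha>] sin_cos_squared_add[of \<phi>] sin_cos_squared_add[of \<delta>]
  unfolding cmod_power2 cos_diff minus_complex.sel times_complex.sel cis.sel
    Re_complex_of_real Im_complex_of_real
  by algebra

lemma diff_eq_cis_Arg2pi: "z - w = complex_of_real (dist w z) * cis (Arg2pi (z - w))"
  using Arg2pi_eq[of "z - w"] by (simp add: cis_conv_exp dist_norm norm_minus_commute)

lemma eq_mult_sqrt: "0 \<le> r \<Longrightarrow> 0 \<le> e \<Longrightarrow> e\<^sup>2 = r\<^sup>2 * q \<Longrightarrow> e = r * sqrt q"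
  for e r q :: real
  by (metis real_sqrt_mult real_sqrt_unique)

lemma short_detour:
  assumes cone: "b \<in> cone5 i a" "c \<in> cone5 i a" "a \<in> cone5 j b" "d \<in> cone5 j b"
    and le: "dist a c \<le> dist a b" "dist b d \<le> dist a b"
  obtains "dist a c + (2 + sqrt 3) * dist c b \<le> (2 + sqrt 3) * dist a b"
  | "dist b d + (2 + sqrt 3) * dist d a \<le> (2 + sqrt 3) * dist a b"
  | "dist a c + dist b d + (2 + sqrt 3) * dist c d \<le> (2 + sqrt 3) * dist a b"
proof -
  define r where "r = dist a b"
  define x where "x = dist a c / r"
  define y where "y = dist b d / r"
  define \<phi> where "\<phi> = Arg2pi (b - a)"
  define \<alpha> where "\<alpha> = Arg2pi (c - a)"
  define \<psi> where "\<psi> = Arg2pi (a - b)"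
  define \<delta> where "\<delta> = Arg2pi (d - b)"
  have r: "0 < r" using cone by (auto simp: r_def cone5_def)
  have x: "0 < x" "x \<le> 1" and y: "0 < y" "y \<le> 1"
    using cone le r by (auto simp: x_def y_def cone5_def r_def[symmetric])
  have s: "dist a c = r * x" "dist b d = r * y" "dist b a = r"
    using r by (simp_all add: x_def y_def r_def dist_commute)
  have opp: "\<psi> = \<phi> + pi \<or> \<psi> = \<phi> - pi"
    using Arg2pi_minus[of "b - a"] cone by (auto simp: \<phi>_def \<psi>_def cone5_def)
  have z: "c - a = of_real (r * x) * cis \<alpha>" "b - a = of_real r * cis \<phi>"
    "a - b = of_real r * cis \<psi>" "d - b = of_real (r * y) * cis \<delta>"
    using diff_eq_cis_Arg2pi[of c a] diff_eq_cis_Arg2pi[of b a]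
      diff_eq_cis_Arg2pi[of a b] diff_eq_cis_Arg2pi[of d b]
    unfolding s r_def[symmetric] \<alpha>_def[symmetric] \<phi>_def[symmetric] \<psi>_def[symmetric] \<delta>_def[symmetric]
    by this+
  have "c - b = of_real (r * x) * cis \<alpha> - of_real r * cis \<phi>"
    unfolding z(1,2)[symmetric] by simp
  then have "(dist c b)\<^sup>2 = r\<^sup>2 * (1 + x\<^sup>2 - 2 * x * cos (\<alpha> - \<phi>))"
    by (simp only: dist_norm cmod_diff_cis_squared) (simp add: power2_eq_square algebra_simps)
  then have cb: "dist c b = r * sqrt (1 + x\<^sup>2 - 2 * x * cos (\<alpha> - \<phi>))"
    using r by (intro eq_mult_sqrt) auto
  have "d - a = of_real (r * y) * cis \<delta> - of_real r * cis \<psi>"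
    unfolding z(3,4)[symmetric] by simp
  then have "(dist d a)\<^sup>2 = r\<^sup>2 * (1 + y\<^sup>2 - 2 * y * cos (\<psi> - \<delta>))"
    by (simp only: dist_norm cmod_diff_cis_squared cos_minus[of "\<psi> - \<delta>", symmetric])
      (simp add: power2_eq_square algebra_simps)
  then have da: "dist d a = r * sqrt (1 + y\<^sup>2 - 2 * y * cos (\<psi> - \<delta>))"
    using r by (intro eq_mult_sqrt) auto
  \<comment> \<open>The half turn between \<open>\<phi>\<close> and \<open>\<psi>\<close> only
    changes signs, so \<open>dist c d\<close> depends on the two base angles alone.\<close>
  have c1: "cos (\<phi> - \<delta>) = - cos (\<psi> - \<delta>)" "cos (\<alpha> - \<delta>) = - cos ((\<alpha> - \<phi>) + (\<psi> - \<delta>))"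
  proof -
    have "\<phi> - \<delta> = (\<psi> - \<delta>) - pi \<and> \<alpha> - \<delta> = ((\<alpha> - \<phi>) + (\<psi> - \<delta>)) - pi \<or>
          \<phi> - \<delta> = (\<psi> - \<delta>) + pi \<and> \<alpha> - \<delta> = ((\<alpha> - \<phi>) + (\<psi> - \<delta>)) + pi"
      using opp by auto
    then show "cos (\<phi> - \<delta>) = - cos (\<psi> - \<delta>)" "cos (\<alpha> - \<delta>) = - cos ((\<alpha> - \<phi>) + (\<psi> - \<delta>))"
      by (metis cos_minus_pi cos_periodic_pi)+
  qed
  have "c - d = of_real (r * x) * cis \<alpha> - of_real r * cis \<phi> - of_real (r * y) * cis \<delta>"
    unfolding z(1,2,4)[symmetric] by simp
  then have "(dist c d)\<^sup>2 = r\<^sup>2 * (1 + x\<^sup>2 + y\<^sup>2 - 2 * x * cos (\<alpha> - \<phi>) - 2 * y * cos (\<psi> - \<delta>)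
      + 2 * x * y * cos ((\<alpha> - \<phi>) + (\<psi> - \<delta>)))"
    by (simp only: dist_norm cmod_diff_diff_cis_squared c1)
      (simp add: power2_eq_square algebra_simps)
  then have cd: "dist c d = r * sqrt (1 + x\<^sup>2 + y\<^sup>2 - 2 * x * cos (\<alpha> - \<phi>) - 2 * y * cos (\<psi> - \<delta>)
      + 2 * x * y * cos ((\<alpha> - \<phi>) + (\<psi> - \<delta>)))"
    using r by (intro eq_mult_sqrt) auto
  have scale: "r * u + (2 + sqrt 3) * (r * w) \<le> (2 + sqrt 3) * r \<longleftrightarrow> u + (2 + sqrt 3) * w \<le> 2 + sqrt 3"
    for u w
  proof -
    have "r * u + (2 + sqrt 3) * (r * w) = r * (u + (2 + sqrt 3) * w)" "(2 + sqrt 3) * r = r * (2 + sqrt 3)"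
      by (simp_all only: algebra_simps)
    then show ?thesis using r by (simp only: mult_le_cancel_left_pos)
  qed
  show ?thesis
  proof (cases "dist a c + (2 + sqrt 3) * dist c b \<le> (2 + sqrt 3) * dist a b \<or>
      dist b d + (2 + sqrt 3) * dist d a \<le> (2 + sqrt 3) * dist a b")
    case True
    then show ?thesis using that(1,2) by blast
  next
    case False
    then have f: "cos (\<alpha> - \<phi>) < 2 - sqrt 3 + (2 * sqrt 3 - 3) * x"
      "cos (\<psi> - \<delta>) < 2 - sqrt 3 + (2 * sqrt 3 - 3) * y"
      unfolding s(1,2) cb da r_def[symmetric] scale
      by (auto intro!: one_edge_fails x y)
    have m: "(2 * sqrt 3 - 3) * w \<le> 2 * sqrt 3 - 3" if "w \<le> 1" for w
      using mult_left_mono[OF that, of "2 * sqrt 3 - 3"] sqrt3_bounds by simp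
    have c: "cos (\<alpha> - \<phi>) < 4/5" "cos (\<psi> - \<delta>) < 4/5"
      using f m[OF x(2)] m[OF y(2)] sqrt3_bounds by linarith+
    have I: "2*pi*(real i - 1)/5 \<le> \<phi>" "\<phi> < 2*pi*real i/5"
      "2*pi*(real i - 1)/5 \<le> \<alpha>" "\<alpha> < 2*pi*real i/5"
      "2*pi*(real j - 1)/5 \<le> \<psi>" "\<psi> < 2*pi*real j/5"
      "2*pi*(real j - 1)/5 \<le> \<delta>" "\<delta> < 2*pi*real j/5"
      using cone by (auto simp: cone5_def \<phi>_def \<alpha>_def \<psi>_def \<delta>_def)
    \<comment> \<open>Two directions in one cone differ by less than 2 pi/5.\<close>
    have "2*pi*(real n - 1)/5 = 2*pi*real n/5 - 2*pi/5" for n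
      by (simp add: field_simps)
    then have "\<bar>\<alpha> - \<phi>\<bar> \<le> pi" "\<bar>\<psi> - \<delta>\<bar> \<le> pi"
      using I pi_gt_zero unfolding abs_le_iff by (auto simp: field_simps)
    then have big: "pi/5 < \<bar>\<alpha> - \<phi>\<bar>" "pi/5 < \<bar>\<psi> - \<delta>\<bar>"
      using c cos_less_imp_abs_gt by blast+
    have "x + y + (2 + sqrt 3) * sqrt (1 + x\<^sup>2 + y\<^sup>2 - 2 * x * cos (\<alpha> - \<phi>) - 2 * y * cos (\<psi> - \<delta>)
      + 2 * x * y * cos ((\<alpha> - \<phi>) + (\<psi> - \<delta>))) \<le> 2 + sqrt 3"
      using cone_angles[OF I opp big]
    proof
      assume "pi/5 \<le> \<alpha> - \<phi> \<and> pi/5 \<le> \<psi> - \<delta> \<and> (\<alpha> - \<phi>) + (\<psi> - \<delta>) \<le> 3*pi/5"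
      then show ?thesis by (intro two_edges x y f) auto
    next
      assume *: "pi/5 \<le> \<phi> - \<alpha> \<and> pi/5 \<le> \<delta> - \<psi> \<and> (\<phi> - \<alpha>) + (\<delta> - \<psi>) \<le> 3*pi/5"
      \<comment> \<open>Reflection: \<open>two_edges\<close> applies to the negated angles, which
        have the same cosines.\<close>
      have e: "cos (\<alpha> - \<phi>) = cos (\<phi> - \<alpha>)" "cos (\<psi> - \<delta>) = cos (\<delta> - \<psi>)"
        "cos ((\<alpha> - \<phi>) + (\<psi> - \<delta>)) = cos ((\<phi> - \<alpha>) + (\<delta> - \<psi>))"
        using cos_minus[of "\<phi> - \<alpha>"] cos_minus[of "\<delta> - \<psi>"] cos_minus[of "(\<phi> - \<alpha>) + (\<delta> - \<psi>)"]
        by (simp_all add: algebra_simps)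
      show ?thesis using * f unfolding e by (intro two_edges x y) auto
    qed
    then have "dist a c + dist b d + (2 + sqrt 3) * dist c d \<le> (2 + sqrt 3) * dist a b"
      unfolding s(1,2) cd r_def[symmetric] distrib_left[symmetric] scale .
    then show ?thesis using that(3) by blast
  qed
qed

subsection \<open>Walks in the Yao graph\<close>

lemma ex_cone5:
  assumes "q \<noteq> p"
  obtains i where "i \<in> {1..5}" "q \<in> cone5 i p"
proof -
  define t where "t = Arg2pi (q - p) * 5 / (2 * pi)"
  have t: "0 \<le> t" "t < 5"
    using Arg2pi_ge_0[of "q - p"] Arg2pi_lt_2pi[of "q - p"]
    by (simp_all add: t_def divide_simps)
  have A: "Arg2pi (q - p) = 2 * pi * t / 5" by (simp add: t_def)
  \<comment> \<open>Cones are numbered from 1, hence the shift.\<close>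
  define i where "i = nat \<lfloor>t\<rfloor> + 1"
  have "real i = of_int \<lfloor>t\<rfloor> + 1" using t by (simp add: i_def)
  then have i: "real i - 1 \<le> t" "t < real i" by linarith+
  have "real i < 6" using i t by linarith
  then have "i \<in> {1..5}" by (auto simp: i_def)
  moreover have "q \<in> cone5 i p"
    using i assms by (simp add: cone5_def A divide_right_mono)
  ultimately show ?thesis by (rule that)
qed

text \<open>The order laws hold only on \<open>point_pairs S\<close>, so the induction on
  \<open>T\<close> first places every compared pair there.\<close>

lemma ex_least_pair:
  assumes adm: "admissible_ordering S prec" and p: "p \<in> S"
    and T: "finite T" "T \<noteq> {}" "T \<subseteq> S - {p}"
  obtains q where "q \<in> T" "\<forall>r\<in>T. r \<noteq> q \<longrightarrow> prec {p, q} {p, r}"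
proof -
  have "\<exists>q\<in>T. \<forall>r\<in>T. r \<noteq> q \<longrightarrow> prec {p, q} {p, r}"
    using T
  proof (induction T rule: finite_ne_induct)
    case (singleton x)
    then show ?case by simp
  next
    case (insert x F)
    then obtain q where q: "q \<in> F" "\<forall>r\<in>F. r \<noteq> q \<longrightarrow> prec {p, q} {p, r}" by auto
    have pp: "{p, r} \<in> point_pairs S" if "r \<in> insert x F" for r
      using that insert.prems p by (fastforce simp: point_pairs_def)
    have tr: "transp_on (point_pairs S) prec" and tot: "totalp_on (point_pairs S) prec"
      using adm by (simp_all add: admissible_ordering_def)
    have "{p, x} \<noteq> {p, q}" using q insert by (auto simp: doubleton_eq_iff)
    then consider "prec {p, x} {p, q}" | "prec {p, q} {p, x}"
      using totalp_onD[OF tot pp[of x] pp[of q]] q(1) by auto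
    then show ?case
    proof cases
      case 1
      then have "prec {p, x} {p, r}" if "r \<in> F" for r
        using transp_onD[OF tr pp[of x] pp[of q] pp[of r] 1] 1 q that by (cases "r = q") simp_all
      then show ?thesis by auto
    next
      case 2
      then show ?thesis using q by auto
    qed
  qed
  then show ?thesis using that by blast
qed

text \<open>A neighbour \<open>c\<close> farther away than \<open>q\<close> would put
  \<open>{p, q}\<close> before \<open>{p, c}\<close>, against the minimality of \<open>c\<close>.
  Both arcs exist because \<open>yao5\<close> is a symmetric closure.\<close>

lemma yao5_neighbour:
  assumes S: "finite S" and adm: "admissible_ordering S prec"
    and pq: "p \<in> S" "q \<in> S" "p \<noteq> q"
  obtains i c where "q \<in> cone5 i p" "c \<in> cone5 i p" "c \<in> S" "dist p c \<le> dist p q"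
    "(p, c) \<in> parcs (yao5 S prec)" "(c, p) \<in> parcs (yao5 S prec)"
proof -
  obtain i where i: "i \<in> {1..5}" "q \<in> cone5 i p" using ex_cone5 pq by metis
  have T: "finite (S \<inter> cone5 i p)" "S \<inter> cone5 i p \<noteq> {}" "S \<inter> cone5 i p \<subseteq> S - {p}"
    using S pq i by (auto simp: cone5_def)
  obtain c where c: "c \<in> S \<inter> cone5 i p" "\<forall>r\<in>S \<inter> cone5 i p. r \<noteq> c \<longrightarrow> prec {p, c} {p, r}"
    using ex_least_pair[OF adm pq(1) T] .
  have cp: "c \<noteq> p" using c by (auto simp: cone5_def)
  have d: "dist p c \<le> dist p q"
  proof (rule ccontr)
    assume far: "\<not> ?thesis"
    then have "prec {p, q} {p, c}"
      using adm pq c cp by (auto simp: admissible_ordering_def)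
    moreover have "prec {p, c} {p, q}"
      using c pq i far by auto
    moreover have "{p, c} \<in> point_pairs S" "{p, q} \<in> point_pairs S"
      using pq c cp by (auto simp: point_pairs_def)
    ultimately show False
      using adm unfolding admissible_ordering_def transp_on_def irreflp_on_def by blast
  qed
  have "(p, c) \<in> parcs (directed_yao5 S prec)"
    using pq i c by (auto simp: directed_yao5_def)
  then have "(p, c) \<in> parcs (yao5 S prec)" "(c, p) \<in> parcs (yao5 S prec)"
    unfolding yao5_def parcs_mk_symmetric by (auto intro!: bexI[of _ "(p, c)"])
  then show ?thesis using that i c d by blast
qed

section \<open>Walks of bounded length and the induction\<close>

text \<open>A real bound witnessed by a walk: such bounds add up under concatenation, without
  handling infima.\<close>

definition walk_within :: "complex pair_pre_digraph \<Rightarrow> real \<Rightarrow> complex \<Rightarrow> complex \<Rightarrow> bool" where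
  "walk_within G l u v \<longleftrightarrow>
     (\<exists>p. pre_digraph.awalk (with_proj G) u p v \<and> (\<Sum>(x, y)\<leftarrow>p. dist x y) \<le> l)"

context
  fixes G :: "complex pair_pre_digraph"
  assumes G: "wf_digraph (with_proj G)"
begin

interpretation wf_digraph "with_proj G" by (rule G)

lemma walk_within_refl: "u \<in> pverts G \<Longrightarrow> walk_within G 0 u u"
  unfolding walk_within_def by (intro exI[of _ "[]"]) (simp add: awalk_Nil_iff)

lemma walk_within_arc:
  assumes "(u, v) \<in> parcs G"
  shows "walk_within G (dist u v) u v"
  unfolding walk_within_def
  using arc_implies_awalk[of "(u, v)"] assms by (intro exI[of _ "[(u, v)]"]) simp

lemma walk_within_trans:
  assumes "walk_within G l u v" "walk_within G l' v w"
  shows "walk_within G (l + l') u w"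
proof -
  from assms obtain p q where "awalk u p v" "(\<Sum>(x, y)\<leftarrow>p. dist x y) \<le> l"
    "awalk v q w" "(\<Sum>(x, y)\<leftarrow>q. dist x y) \<le> l'"
    by (auto simp: walk_within_def)
  then show ?thesis unfolding walk_within_def
    by (intro exI[of _ "p @ q"]) auto
qed

end

lemma walk_within_mono: "walk_within G l u v \<Longrightarrow> l \<le> l' \<Longrightarrow> walk_within G l' u v"
  unfolding walk_within_def by fastforce

lemma graph_dist_yao5_le:
  assumes "walk_within (yao5 S prec) l u v"
  shows "graph_dist (yao5 S prec) u v \<le> ereal l"
  using assms unfolding graph_dist_yao5 walk_within_def by (auto intro: INF_lower2)

lemma walk_within_yao5:
  assumes S: "finite S" and adm: "admissible_ordering S prec" and "u \<in> S" "v \<in> S"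
  shows "walk_within (yao5 S prec) ((2 + sqrt 3) * dist u v) u v"
  using assms(3,4)
\<comment> \<open>The number of closer ordered pairs is a natural-number rank for the distances in
  \<open>S\<close>.\<close>
proof (induction "card {(x, y) \<in> S \<times> S. dist x y < dist u v}" arbitrary: u v rule: less_induct)
  case less
  let ?W = "walk_within (yao5 S prec)"
  note trans = walk_within_trans[OF wf_digraph_yao5] and arc = walk_within_arc[OF wf_digraph_yao5]
  have IH: "?W ((2 + sqrt 3) * dist x y) x y" if "x \<in> S" "y \<in> S" "dist x y < dist u v" for x y
  proof (rule less.hyps)
    have "(x, y) \<in> {(x, y) \<in> S \<times> S. dist x y < dist u v}"
      "(x, y) \<notin> {(x', y') \<in> S \<times> S. dist x' y' < dist x y}"
      using that by auto
    moreover have "{(x', y') \<in> S \<times> S. dist x' y' < dist x y} \<subseteq> {(x, y) \<in> S \<times> S. dist x y < dist u v}"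
      using that by auto
    ultimately have "{(x', y') \<in> S \<times> S. dist x' y' < dist x y} \<subset> {(x, y) \<in> S \<times> S. dist x y < dist u v}"
      by blast
    moreover have "finite {(x, y) \<in> S \<times> S. dist x y < dist u v}"
      by (rule finite_subset[of _ "S \<times> S"]) (use S in auto)
    ultimately show "card {(x', y') \<in> S \<times> S. dist x' y' < dist x y}
        < card {(x, y) \<in> S \<times> S. dist x y < dist u v}"
      by (rule psubset_card_mono[rotated])
  qed (use that in auto)
  \<comment> \<open>As the Yao edges of a detour have positive length \<open>w\<close>, the
    remaining gap \<open>e\<close> is strictly smaller and the induction hypothesis applies.\<close>
  have lt: "e < l" if "0 < w" "w + (2 + sqrt 3) * e \<le> (2 + sqrt 3) * l" for e l w :: real
  proof -
    have "(2 + sqrt 3) * e < (2 + sqrt 3) * l" using that by linarith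
    then show ?thesis by (simp add: mult_less_cancel_left_pos add_pos_pos)
  qed
  show ?case
  proof (cases "u = v")
    case True
    then show ?thesis
      using walk_within_refl[OF wf_digraph_yao5] less.prems by (simp add: yao5_def directed_yao5_def)
  next
    case False
    obtain i c where c: "v \<in> cone5 i u" "c \<in> cone5 i u" "c \<in> S" "dist u c \<le> dist u v"
      "(u, c) \<in> parcs (yao5 S prec)"
      using yao5_neighbour[OF S adm less.prems False] by metis
    obtain j d where d: "u \<in> cone5 j v" "d \<in> cone5 j v" "d \<in> S" "dist v d \<le> dist u v"
      "(d, v) \<in> parcs (yao5 S prec)"
      using yao5_neighbour[OF S adm less.prems(2,1)] False by (metis dist_commute)
    have pos: "0 < dist u c" "0 < dist v d" using c d by (auto simp: cone5_def)
    from c(1,2) d(1,2) c(4) d(4) show ?thesis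
    proof (cases rule: short_detour)
      case 1
      then have "?W ((2 + sqrt 3) * dist c v) c v"
        using lt pos c less.prems by (intro IH) blast+
      then show ?thesis using trans[OF arc[OF c(5)]] 1 walk_within_mono by blast
    next
      case 2
      then have "?W ((2 + sqrt 3) * dist u d) u d"
        using lt pos d less.prems unfolding dist_commute[of d u] by (intro IH) blast+
      then have "?W ((2 + sqrt 3) * dist u d + dist d v) u v"
        using trans arc[OF d(5)] by blast
      then show ?thesis using 2 walk_within_mono by (simp add: dist_commute add.commute)
    next
      case 3
      then have "?W ((2 + sqrt 3) * dist c d) c d"
        using lt[of "dist u c + dist v d"] pos c d by (intro IH) auto
      then have "?W (dist u c + ((2 + sqrt 3) * dist c d + dist d v)) u v"
        using trans arc[OF c(5)] arc[OF d(5)] by blast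
      then show ?thesis
        by (rule walk_within_mono) (use 3 in \<open>simp add: dist_commute\<close>)
    qed
  qed
qed

theorem theorem1:
  fixes S :: "complex set"
    and prec :: "complex set \<Rightarrow> complex set \<Rightarrow> bool"
  assumes "finite S"
    and "admissible_ordering S prec"
  shows "spanner (2 + sqrt 3) (yao5 S prec)"
proof -
  have "pverts (yao5 S prec) = S" by (simp add: yao5_def directed_yao5_def)
  then show ?thesis
    unfolding spanner_def using walk_within_yao5[OF assms] graph_dist_yao5_le by blast
qed

end
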